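(* Let $f:\mathbb{R}^n\to\mathbb{R}$ be a measurable symmetric function, $\mathbf F\in\mathcal M^n$ and $\Lambda\in\mathcal Q_n$. Then $\mathcal D_f(\mathbf F)\subset\mathcal D_f(\Lambda\mathbf F)$. In particular, $\mathcal D_n(\mathbf F)\subset\mathcal D_n(\Lambda\mathbf F)$.
   Context: Work on an atomless probability space. $\mathcal M$ is the set of cdfs on $\mathbb{R}$; $X\sim F$ means $X$ has cdf $F$. A function $f$ is symmetric if $f(\mathbf x)=f(\pi(\mathbf x))$ for all $\mathbf x\in\mathbb{R}^n$ and all permutations $\pi$. For $\mathbf F=(F_1,\dots,F_n)\in\mathcal M^n$: $\mathcal D_f(\mathbf F)=\{\text{cdf of } f(X_1,\dots,X_n): X_i\sim F_i,\ i=1,\dots,n\}$, and $\mathcal D_n(\mathbf F)$ is $\mathcal D_f(\mathbf F)$ with $f(x_1,\dots,x_n)=x_1+\dots+x_n$. $\mathcal Q_n$ is the set of $n\times n$ doubly stochastic matrices (nonnegative entries, every row and column sums to 1). For $\Lambda=(\Lambda_{ij})\in\mathcal Q_n$, $\Lambda\mathbf F$ is the tuple whose $i$-th component is the cdf $\sum_{j=1}^n\Lambda_{ij}F_j$ (distribution mixture). *)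

theory Defs
  imports "HOL-Probability.Probability"
begin

definition cdfs :: "(real \<Rightarrow> real) set" where
  "cdfs = {F. \<exists>\<mu>. real_distribution \<mu> \<and> F = cdf \<mu>}"

definition atomless :: "'a measure \<Rightarrow> bool" where
  "atomless M \<longleftrightarrow> (\<forall>A\<in>sets M. 0 < measure M A \<longrightarrow>
      (\<exists>B\<in>sets M. B \<subseteq> A \<and> 0 < measure M B \<and> measure M B < measure M A))"

definition rv_cdf :: "'a measure \<Rightarrow> ('a \<Rightarrow> real) \<Rightarrow> real \<Rightarrow> real" where
  "rv_cdf M X = cdf (distr M borel X)"

definition symmetric_fun :: "(real ^ 'n \<Rightarrow> real) \<Rightarrow> bool" where
  "symmetric_fun f \<longleftrightarrow> (\<forall>x \<pi>. \<pi> permutes (UNIV :: 'n set) \<longrightarrow> f (\<chi> i. x $ \<pi> i) = f x)"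

definition Dset :: "'a measure \<Rightarrow> (real ^ 'n \<Rightarrow> real) \<Rightarrow> ('n \<Rightarrow> real \<Rightarrow> real)
    \<Rightarrow> (real \<Rightarrow> real) set" where
  "Dset M f F = {rv_cdf M (\<lambda>\<omega>. f (\<chi> i. X i \<omega>)) | X.
      (\<forall>i. X i \<in> borel_measurable M \<and> rv_cdf M (X i) = F i)}"

definition doubly_stochastic :: "real ^ 'n ^ 'n \<Rightarrow> bool" where
  "doubly_stochastic L \<longleftrightarrow> (\<forall>i j. 0 \<le> L $ i $ j) \<and>
     (\<forall>i. (\<Sum>j\<in>UNIV. L $ i $ j) = 1) \<and> (\<forall>j. (\<Sum>i\<in>UNIV. L $ i $ j) = 1)"

definition mix :: "real ^ 'n ^ 'n \<Rightarrow> ('n \<Rightarrow> real \<Rightarrow> real) \<Rightarrow> ('n \<Rightarrow> real \<Rightarrow> real)" where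
  "mix L F = (\<lambda>i x. \<Sum>j\<in>UNIV. L $ i $ j * F j x)"

end

theory Submission
  imports Defs
begin

text \<open>By Birkhoff's theorem, \<open>L\<close> is the matrix of probabilities that \<open>\<pi> i = j\<close> for some random
  permutation \<open>\<pi>\<close>. If \<open>\<pi>\<close> were independent of \<open>X\<close>, the vector \<open>i \<mapsto> X (\<pi> i)\<close> would have the
  marginals \<open>mix L F\<close>, while \<open>f\<close> takes the same value on it as on \<open>X\<close> by symmetry. Since \<open>X\<close> may
  generate the whole \<open>\<sigma>\<close>-algebra, such a \<open>\<pi>\<close> need not exist on \<open>M\<close>; but only the law of the permuted
  vector matters, and an atomless space carries a random vector with any prescribed law on
  \<open>real ^ 'n\<close>. The extreme points in Birkhoff's theorem are found by a dimension count: the fractional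
  entries of an extreme doubly stochastic matrix are the edges of a bipartite graph without
  vertices of degree 1, and such a graph supports a nonzero perturbation with vanishing row and
  column sums.\<close>

section \<open>Real random variables on an atomless space\<close>

text \<open>Members of equal measure are forced to coincide. A maximal chain for plain inclusion would not
  do: it may contain uncountably many sets of the same measure, and their union need not be
  measurable.\<close>

definition maximal_measure_chain :: "'a measure \<Rightarrow> 'a set set \<Rightarrow> bool" where
  "maximal_measure_chain M C \<longleftrightarrow> C \<subseteq> sets M \<and>
     (\<forall>X\<in>C. \<forall>Y\<in>C. measure M X \<le> measure M Y \<longrightarrow> X \<subseteq> Y) \<and>
     (\<forall>D\<in>sets M. (\<forall>X\<in>C. (measure M X \<le> measure M D \<longrightarrow> X \<subseteq> D) \<and>
        (measure M D \<le> measure M X \<longrightarrow> D \<subseteq> X)) \<longrightarrow> D \<in> C)"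

lemma maximal_measure_chainD:
  assumes "maximal_measure_chain M C"
  shows "C \<subseteq> sets M"
    and "\<And>X Y. X \<in> C \<Longrightarrow> Y \<in> C \<Longrightarrow> measure M X \<le> measure M Y \<Longrightarrow> X \<subseteq> Y"
    and "\<And>D. D \<in> sets M \<Longrightarrow> (\<And>X. X \<in> C \<Longrightarrow> measure M X \<le> measure M D \<Longrightarrow> X \<subseteq> D) \<Longrightarrow>
      (\<And>X. X \<in> C \<Longrightarrow> measure M D \<le> measure M X \<Longrightarrow> D \<subseteq> X) \<Longrightarrow> D \<in> C"
  using assms unfolding maximal_measure_chain_def by simp_all

text \<open>Zorn's lemma, applied to the families in which the order of the measures decides
  inclusion. The union of a chain of such families is again one, since any two of its members
  already lie in a common family; a measurable set comparable with all members could be inserted, so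
  a maximal family contains it.\<close>

lemma maximal_measure_chain_exists: "\<exists>C. maximal_measure_chain M C"
proof -
  define \<A> where "\<A> = {C. C \<subseteq> sets M \<and>
    (\<forall>X\<in>C. \<forall>Y\<in>C. measure M X \<le> measure M Y \<longrightarrow> X \<subseteq> Y)}"
  have "\<Union>\<C> \<in> \<A>" if \<C>: "subset.chain \<A> \<C>" for \<C>
  proof -
    have "X \<subseteq> Y" if "X \<in> \<Union>\<C>" "Y \<in> \<Union>\<C>" "measure M X \<le> measure M Y" for X Y
    proof -
      from that obtain C D where "C \<in> \<C>" "X \<in> C" "D \<in> \<C>" "Y \<in> D" by blast
      moreover from \<C> this have "C \<subseteq> D \<or> D \<subseteq> C" by (simp add: subset_chain_def)
      moreover from \<C> \<open>C \<in> \<C>\<close> \<open>D \<in> \<C>\<close> have "C \<in> \<A>" "D \<in> \<A>" by (auto simp: subset_chain_def)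
      ultimately show "X \<subseteq> Y" using that(3) unfolding \<A>_def by blast
    qed
    moreover have "\<Union>\<C> \<subseteq> sets M"
      using \<C> by (auto simp: subset_chain_def \<A>_def)
    ultimately show ?thesis by (simp add: \<A>_def)
  qed
  then obtain C where C: "C \<in> \<A>" and max: "\<And>X. X \<in> \<A> \<Longrightarrow> C \<subseteq> X \<Longrightarrow> X = C"
    using subset_Zorn'[of \<A>] by blast
  have "D \<in> C" if "D \<in> sets M" "\<forall>X\<in>C. (measure M X \<le> measure M D \<longrightarrow> X \<subseteq> D) \<and>
      (measure M D \<le> measure M X \<longrightarrow> D \<subseteq> X)" for D
  proof -
    from that have "insert D C \<in> \<A>" using C by (auto simp: \<A>_def)
    then show "D \<in> C" using max[of "insert D C"] by blast
  qed
  then have "maximal_measure_chain M C"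
    using C unfolding \<A>_def maximal_measure_chain_def by blast
  then show ?thesis ..
qed

text \<open>The supremum \<open>s\<close> of the measures up to \<open>t\<close> is attained.
  Otherwise some sequence of members has measures tending to \<open>s\<close>; since measures decide
  inclusion, its union is comparable with every member, and maximality puts it into
  \<open>C\<close>.\<close>

lemma (in finite_measure) Sup_in_maximal_measure_chain:
  assumes C: "maximal_measure_chain M C"
    and "0 \<le> t"
  obtains X where "X \<in> C" "measure M X \<le> t"
    and "\<And>Y. Y \<in> C \<Longrightarrow> measure M Y \<le> t \<Longrightarrow> Y \<subseteq> X"
proof -
  note sets = maximal_measure_chainD(1)[OF C]
    and chain = maximal_measure_chainD(2)[OF C]
    and max = maximal_measure_chainD(3)[OF C]
  define S where "S = {X \<in> C. measure M X \<le> t}"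
  define s where "s = (SUP X\<in>S. measure M X)"
  \<comment> \<open>Without a null member, the empty set would be comparable with all of
    \<open>C\<close> and hence belong to it.\<close>
  have zero: "\<exists>X\<in>C. measure M X = 0"
  proof (rule ccontr)
    assume no: "\<not> (\<exists>X\<in>C. measure M X = 0)"
    have "{} \<in> C"
    proof (rule max)
      fix X assume "X \<in> C" "measure M X \<le> measure M {}"
      then show "X \<subseteq> {}" using no by (auto simp: measure_le_0_iff)
    qed auto
    with no show False by force
  qed
  then have ne: "S \<noteq> {}" using \<open>0 \<le> t\<close> by (auto simp: S_def)
  have bdd: "bdd_above (measure M ` S)" by (auto simp: S_def)
  have le_s: "measure M X \<le> s" if "X \<in> S" for X
    unfolding s_def using that bdd by (rule cSUP_upper)
  have s_le: "s \<le> t" unfolding s_def using ne by (intro cSUP_least) (auto simp: S_def)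
  have "\<exists>X\<in>C. measure M X = s"
  proof (rule ccontr)
    assume no: "\<not> (\<exists>X\<in>C. measure M X = s)"
    have "\<exists>X\<in>S. s - 1 / Suc n < measure M X" for n
      using less_cSUP_iff[OF ne bdd, of "s - 1 / Suc n"] unfolding s_def by simp
    then obtain X where X: "\<And>n. X n \<in> S" "\<And>n. s - 1 / Suc n < measure M (X n)" by metis
    then have XC: "X n \<in> C" for n by (simp add: S_def)
    then have Xm[measurable]: "X n \<in> sets M" for n using sets by blast
    define U where "U = (\<Union>n. X n)"
    have Um[measurable]: "U \<in> sets M" by (simp add: U_def)
    \<comment> \<open>Of two nested sets the union is the larger one, so finite unions stay in
      \<open>S\<close>; continuity from below then bounds the measure of \<open>U\<close> by
      \<open>s\<close>.\<close>
    have fin: "(\<Union>i\<le>n. X i) \<in> S" for n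
    proof (induction n)
      case (Suc n)
      have *: "(\<Union>i\<le>Suc n. X i) = (\<Union>i\<le>n. X i) \<union> X (Suc n)"
        by (simp add: atMost_Suc Un_commute)
      have "(\<Union>i\<le>n. X i) \<subseteq> X (Suc n) \<or> X (Suc n) \<subseteq> (\<Union>i\<le>n. X i)"
        using Suc.IH X(1)[of "Suc n"] chain unfolding S_def by (metis (lifting) linear mem_Collect_eq)
      then show ?case
        using Suc.IH X(1)[of "Suc n"] unfolding * by (metis Un_absorb1 Un_absorb2)
    qed (simp add: X)
    have "(\<lambda>n. measure M (\<Union>i\<le>n. X i)) \<longlonglongrightarrow> measure M (\<Union>n. \<Union>i\<le>n. X i)"
      by (rule finite_Lim_measure_incseq) (auto simp: incseq_def, fastforce)
    then have "measure M (\<Union>n. \<Union>i\<le>n. X i) \<le> s"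
      by (rule LIMSEQ_le_const2) (use fin le_s in auto)
    moreover have "(\<Union>n. \<Union>i\<le>n. X i) = U" by (auto simp: U_def)
    ultimately have U_le: "measure M U \<le> s" by simp
    have "X n \<subseteq> U" for n by (auto simp: U_def)
    then have XU: "measure M (X n) \<le> measure M U" for n by (intro finite_measure_mono) auto
    have above: "\<exists>n. a < measure M (X n)" if "a < s" for a
    proof -
      obtain n where "1 / Suc n < s - a" using \<open>a < s\<close> nat_approx_posE[of "s - a"] by auto
      with X(2)[of n] show ?thesis by (intro exI[of _ n]) linarith
    qed
    have U_eq: "measure M U = s"
      using U_le above[of "measure M U"] XU by (meson leD le_less_linear order_antisym)
    \<comment> \<open>No member has measure exactly \<open>s\<close>: those below \<open>s\<close>
      lie inside some \<open>X n\<close>, those above contain every \<open>X n\<close>.\<close>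
    have "U \<in> C"
    proof (rule max)
      fix Y assume Y: "Y \<in> C" "measure M Y \<le> measure M U"
      then have "measure M Y < s" using no U_eq by (metis order_le_imp_less_or_eq)
      then obtain n where "measure M Y < measure M (X n)" using above by blast
      then have "Y \<subseteq> X n" using chain Y XC by simp
      then show "Y \<subseteq> U" by (auto simp: U_def)
    next
      fix Y assume Y: "Y \<in> C" "measure M U \<le> measure M Y"
      then have "X n \<subseteq> Y" for n
        using chain XC XU[of n] by (meson order_trans)
      then show "U \<subseteq> Y" by (auto simp: U_def)
    qed simp
    with U_eq no show False by blast
  qed
  then obtain X where X: "X \<in> C" "measure M X = s" by blast
  then show thesis using s_le le_s chain by (intro that[of X]) (auto simp: S_def)
qed

text \<open>A maximal chain skips no value \<open>t\<close>. Otherwise its largest member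
  \<open>U\<close> below \<open>t\<close> and its smallest member \<open>V\<close> above
  \<open>t\<close> leave a gap \<open>V - U\<close> of positive measure; atomlessness cuts out a
  part \<open>B\<close>, and \<open>U \<union> B\<close> is comparable with every member but has a
  measure inside the gap.\<close>

lemma (in prob_space) atomless_chain:
  assumes "atomless M"
  obtains A where "\<And>t. 0 \<le> t \<Longrightarrow> t \<le> 1 \<Longrightarrow> A t \<in> sets M"
    and "\<And>t. 0 \<le> t \<Longrightarrow> t \<le> 1 \<Longrightarrow> prob (A t) = t"
    and "\<And>s t. 0 \<le> s \<Longrightarrow> s \<le> t \<Longrightarrow> t \<le> 1 \<Longrightarrow> A s \<subseteq> A t"
proof -
  obtain C where C: "maximal_measure_chain M C"
    using maximal_measure_chain_exists by blast
  note sets = maximal_measure_chainD(1)[OF C]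
    and chain = maximal_measure_chainD(2)[OF C]
    and max = maximal_measure_chainD(3)[OF C]
  \<comment> \<open>The complements form a maximal chain too. Its largest member of measure at most
    \<open>1 - t\<close> yields the smallest member of \<open>C\<close> of measure at least
    \<open>t\<close>.\<close>
  define C' where "C' = (\<lambda>X. space M - X) ` C"
  have compl: "prob (space M - X) = 1 - prob X" if "X \<in> sets M" for X
    using that by (rule prob_compl)
  have sets': "C' \<subseteq> sets M" using sets by (auto simp: C'_def)
  have chain': "X \<subseteq> Y" if "X \<in> C'" "Y \<in> C'" "prob X \<le> prob Y" for X Y
  proof -
    from that obtain X0 Y0 where "X0 \<in> C" "Y0 \<in> C" "X = space M - X0" "Y = space M - Y0"
      by (auto simp: C'_def)
    with that(3) sets have "Y0 \<subseteq> X0" by (intro chain) (auto simp: compl subset_iff)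
    then show ?thesis using \<open>X = _\<close> \<open>Y = _\<close> by blast
  qed
  have "D \<in> C'" if D: "D \<in> sets M"
      "\<forall>X\<in>C'. (prob X \<le> prob D \<longrightarrow> X \<subseteq> D) \<and> (prob D \<le> prob X \<longrightarrow> D \<subseteq> X)" for D
  proof -
    have "space M - D \<in> C"
    proof (rule max)
      fix X assume X: "X \<in> C" "prob X \<le> prob (space M - D)"
      then have "X \<in> sets M" using sets by blast
      then have "D \<subseteq> space M - X"
        using X D by (auto simp: C'_def compl)
      then show "X \<subseteq> space M - D" using sets.sets_into_space[OF \<open>X \<in> sets M\<close>] by blast
    next
      fix X assume X: "X \<in> C" "prob (space M - D) \<le> prob X"
      then have "X \<in> sets M" using sets by blast
      then have "space M - X \<subseteq> D"
        using X D by (auto simp: C'_def compl)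
      then show "space M - D \<subseteq> X" by blast
    qed (use D in auto)
    moreover have "D = space M - (space M - D)" using sets.sets_into_space[OF D(1)] by blast
    ultimately show ?thesis unfolding C'_def by blast
  qed
  then have C': "maximal_measure_chain M C'"
    using sets' chain' unfolding maximal_measure_chain_def by blast
  have ex: "\<exists>X\<in>C. prob X = t" if t: "0 \<le> t" "t \<le> 1" for t
  proof (rule ccontr)
    assume no: "\<not> (\<exists>X\<in>C. prob X = t)"
    obtain U where U: "U \<in> C" "prob U \<le> t" "\<And>Y. Y \<in> C \<Longrightarrow> prob Y \<le> t \<Longrightarrow> Y \<subseteq> U"
      by (rule Sup_in_maximal_measure_chain[OF C t(1)]) blast
    have "0 \<le> 1 - t" using t by simp
    then obtain V' where V': "V' \<in> C'" "prob V' \<le> 1 - t"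
      "\<And>Y. Y \<in> C' \<Longrightarrow> prob Y \<le> 1 - t \<Longrightarrow> Y \<subseteq> V'"
      by (rule Sup_in_maximal_measure_chain[OF C']) blast
    then obtain V where V: "V \<in> C" "V' = space M - V" by (auto simp: C'_def)
    have m: "U \<in> sets M" "V \<in> sets M" using U V sets by auto
    have "prob V \<ge> t" using V' V m by (simp add: compl)
    have V_least: "V \<subseteq> Y" if Y: "Y \<in> C" "t \<le> prob Y" for Y
    proof -
      have "Y \<in> sets M" using sets Y by blast
      then have "space M - Y \<subseteq> V'" using Y by (intro V'(3)) (auto simp: C'_def compl)
      then show ?thesis using V(2) sets.sets_into_space[OF m(2)] by blast
    qed
    have lt: "prob U < t" "t < prob V" using U V \<open>prob V \<ge> t\<close> no by (auto simp: order_less_le)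
    then have "U \<subseteq> V" using chain U V by simp
    then have diff: "prob (V - U) = prob V - prob U" using m by (simp add: finite_measure_Diff)
    have "V - U \<in> sets M" "0 < prob (V - U)" using m diff lt by auto
    then obtain B where B: "B \<in> sets M" "B \<subseteq> V - U" "0 < prob B" "prob B < prob (V - U)"
      using assms unfolding atomless_def by blast
    have prUB: "prob (U \<union> B) = prob U + prob B"
      using B m by (intro finite_measure_Union) auto
    have notC: "prob Y \<le> prob U \<or> prob V \<le> prob Y" if "Y \<in> C" for Y
      using finite_measure_mono[OF U(3)[OF that] m(1)] finite_measure_mono[OF V_least[OF that]] sets that
      by (cases "prob Y \<le> t") auto
    have "U \<union> B \<in> C"
    proof (rule max)
      fix X assume X: "X \<in> C" "prob X \<le> prob (U \<union> B)"
      then have "prob X \<le> prob U" using notC[OF X(1)] prUB diff B by linarith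
      then show "X \<subseteq> U \<union> B" using chain X U by blast
    next
      fix X assume X: "X \<in> C" "prob (U \<union> B) \<le> prob X"
      then have "prob V \<le> prob X" using notC[OF X(1)] prUB diff B by linarith
      then have "V \<subseteq> X" using chain X V by blast
      then show "U \<union> B \<subseteq> X" using B \<open>U \<subseteq> V\<close> by blast
    qed (use m B in auto)
    then show False using notC[of "U \<union> B"] prUB diff B by simp
  qed
  then obtain A where A: "\<And>t. 0 \<le> t \<Longrightarrow> t \<le> 1 \<Longrightarrow> A t \<in> C \<and> prob (A t) = t" by metis
  show thesis
  proof (rule that[of A])
    show "A s \<subseteq> A t" if "0 \<le> s" "s \<le> t" "t \<le> 1" for s t
      using A[of s] A[of t] that by (intro chain) auto
  qed (use A sets in auto)
qed

text \<open>\<open>U\<close> is the time at which a point enters the increasing family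
  \<open>A\<close>. The event that \<open>U\<close> is at most \<open>t\<close> contains
  \<open>A t\<close> and lies in \<open>A x\<close> for each \<open>x\<close> in
  \<open>(t, 1]\<close>.\<close>

lemma (in prob_space) atomless_uniform:
  assumes "atomless M"
  obtains U where "U \<in> borel_measurable M"
    and "\<And>t. 0 \<le> t \<Longrightarrow> t \<le> 1 \<Longrightarrow> prob {\<omega> \<in> space M. U \<omega> \<le> t} = t"
proof -
  obtain A where Am: "\<And>t. 0 \<le> t \<Longrightarrow> t \<le> 1 \<Longrightarrow> A t \<in> sets M"
    and Ap: "\<And>t. 0 \<le> t \<Longrightarrow> t \<le> 1 \<Longrightarrow> prob (A t) = t"
    and mono: "\<And>s t. 0 \<le> s \<Longrightarrow> s \<le> t \<Longrightarrow> t \<le> 1 \<Longrightarrow> A s \<subseteq> A t"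
    using atomless_chain[OF assms] by metis
  \<comment> \<open>The inserted 1 keeps \<open>T\<close> nonempty at points that lie in no
    \<open>A t\<close>; such points may exist, as \<open>A 1\<close> only has probability 1.\<close>
  define T where "T \<omega> = insert 1 {t. 0 \<le> t \<and> t \<le> 1 \<and> \<omega> \<in> A t}" for \<omega>
  define U where "U \<omega> = Inf (T \<omega>)" for \<omega>
  have T: "T \<omega> \<noteq> {}" "bdd_below (T \<omega>)" for \<omega>
    unfolding T_def by (auto intro!: bdd_belowI[of _ 0])
  have U_le: "U \<omega> \<le> t" if "t \<in> T \<omega>" for \<omega> t
    unfolding U_def using that T by (intro cInf_lower)
  have U_less: "\<exists>t\<in>T \<omega>. t < x" if "U \<omega> < x" for \<omega> x
    using that T unfolding U_def by (metis cInf_less_iff)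
  \<comment> \<open>Monotonicity of \<open>A\<close> allows rational times only, so the union is
    countable. For \<open>x \<le> 1\<close> the inserted 1 is never below \<open>x\<close>.\<close>
  have less_iff: "{\<omega> \<in> space M. U \<omega> < x} = (if 1 < x then space M
      else (\<Union>q\<in>{q\<in>\<rat>. 0 \<le> q \<and> q < x}. A q))" for x
  proof (cases "1 < x")
    case True
    have "U \<omega> \<le> 1" for \<omega> by (rule U_le) (simp add: T_def)
    then show ?thesis using True by (auto intro: le_less_trans)
  next
    case False
    show ?thesis
    proof (simp only: False if_False, intro equalityI subsetI)
      fix \<omega> assume "\<omega> \<in> {\<omega> \<in> space M. U \<omega> < x}"
      then obtain t where t: "t \<in> T \<omega>" "t < x" using U_less by blast
      obtain q where q: "q \<in> \<rat>" "t < q" "q < x" using Rats_dense_in_real[OF t(2)] by blast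
      have "0 \<le> t" "\<omega> \<in> A t" using t False by (auto simp: T_def)
      then have "\<omega> \<in> A q" using mono[of t q] q False by auto
      then show "\<omega> \<in> (\<Union>q\<in>{q\<in>\<rat>. 0 \<le> q \<and> q < x}. A q)" using q \<open>0 \<le> t\<close> by auto
    next
      fix \<omega> assume "\<omega> \<in> (\<Union>q\<in>{q\<in>\<rat>. 0 \<le> q \<and> q < x}. A q)"
      then obtain q where q: "0 \<le> q" "q < x" "\<omega> \<in> A q" by blast
      then have "U \<omega> \<le> q" using False by (intro U_le) (auto simp: T_def)
      moreover have "\<omega> \<in> space M" using q False Am[of q] sets.sets_into_space by auto
      ultimately show "\<omega> \<in> {\<omega> \<in> space M. U \<omega> < x}" using q by auto
    qed
  qed
  have Um: "U \<in> borel_measurable M"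
    unfolding borel_measurable_iff_less less_iff
    by (auto intro!: sets.countable_UN' Am countable_subset[OF _ countable_rat])
  have "prob {\<omega> \<in> space M. U \<omega> \<le> t} = t" if t: "0 \<le> t" "t \<le> 1" for t
  proof (rule antisym)
    have "t = prob (A t)" using Ap t by simp
    also have "\<dots> \<le> prob {\<omega> \<in> space M. U \<omega> \<le> t}"
    proof (rule finite_measure_mono)
      show "A t \<subseteq> {\<omega> \<in> space M. U \<omega> \<le> t}"
        using t Am[OF t] sets.sets_into_space by (auto intro!: U_le simp: T_def)
    qed (use Um in measurable)
    finally show "t \<le> prob {\<omega> \<in> space M. U \<omega> \<le> t}" .
    show "prob {\<omega> \<in> space M. U \<omega> \<le> t} \<le> t"
    proof (rule dense_ge)
      fix x assume "t < x"
      show "prob {\<omega> \<in> space M. U \<omega> \<le> t} \<le> x"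
      proof (cases "x \<le> 1")
        case True
        have "{\<omega> \<in> space M. U \<omega> \<le> t} \<subseteq> {\<omega> \<in> space M. U \<omega> < x}" using \<open>t < x\<close> by auto
        also have "\<dots> \<subseteq> A x" 
          unfolding less_iff using True mono[of _ x] by (simp add: UN_subset_iff)
        finally have "prob {\<omega> \<in> space M. U \<omega> \<le> t} \<le> prob (A x)"
          using Am[of x] True t \<open>t < x\<close> by (intro finite_measure_mono) auto
        then show ?thesis using Ap[of x] True t \<open>t < x\<close> by simp
      qed (meson le_cases order_trans prob_le_1)
    qed
  qed
  then show thesis by (rule that[OF Um])
qed

text \<open>The quantile transform: the pseudo-inverse \<open>\<mu>.I\<close> of the cdf of
  \<open>\<mu>\<close>, evaluated at a uniform variable, has law \<open>\<mu>\<close>.\<close>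

lemma (in prob_space) atomless_real_distribution:
  assumes "atomless M" and "real_distribution \<mu>"
  obtains Z where "Z \<in> borel_measurable M" "distr M borel Z = \<mu>"
proof -
  interpret \<mu>: cdf_distribution \<mu> using assms(2) by (simp add: cdf_distribution_def)
  obtain U where Um[measurable]: "U \<in> borel_measurable M"
    and Up: "\<And>t. 0 \<le> t \<Longrightarrow> t \<le> 1 \<Longrightarrow> prob {\<omega> \<in> space M. U \<omega> \<le> t} = t"
    using atomless_uniform[OF assms(1)] by metis
  \<comment> \<open>The pseudo-inverse relation is available on the open unit interval. The default
    0 elsewhere affects only a null event.\<close>
  define J where "J u = (if u \<in> {0<..<1} then \<mu>.I u else 0)" for u
  have [measurable]: "J \<in> borel_measurable borel"
    unfolding J_def[abs_def] by (subst measurable_restrict_space_iff[symmetric]) auto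
  have pos: "prob {\<omega> \<in> space M. U \<omega> \<le> 0} = 0" using Up[of 0] by simp
  have "AE \<omega> in M. 0 < U \<omega>"
    using pos by (simp add: prob_Collect_eq_0 not_le)
  moreover have "prob {\<omega> \<in> space M. U \<omega> < 1} = 1"
  proof (rule antisym[OF prob_le_1 dense_le])
    fix t :: real assume "t < 1"
    show "t \<le> prob {\<omega> \<in> space M. U \<omega> < 1}"
    proof (cases "0 \<le> t")
      case True
      then have "t = prob {\<omega> \<in> space M. U \<omega> \<le> t}" using Up \<open>t < 1\<close> by simp
      also have "\<dots> \<le> prob {\<omega> \<in> space M. U \<omega> < 1}"
        using \<open>t < 1\<close> by (intro finite_measure_mono) auto
      finally show ?thesis .
    qed (meson le_cases measure_nonneg order_trans)
  qed
  then have "AE \<omega> in M. U \<omega> < 1" by (simp add: prob_Collect_eq_1)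
  ultimately have AE: "AE \<omega> in M. U \<omega> \<in> {0<..<1}" by eventually_elim simp
  have "cdf (distr M borel (\<lambda>\<omega>. J (U \<omega>))) x = cdf \<mu> x" for x
  proof -
    have "cdf (distr M borel (\<lambda>\<omega>. J (U \<omega>))) x = prob {\<omega> \<in> space M. J (U \<omega>) \<le> x}"
      unfolding cdf_def by (subst measure_distr) (simp_all add: vimage_def Int_def conj_commute)
    also have "\<dots> = prob {\<omega> \<in> space M. U \<omega> \<le> cdf \<mu> x}"
    proof (rule measure_eq_AE)
      show "AE \<omega> in M. \<omega> \<in> {\<omega> \<in> space M. J (U \<omega>) \<le> x} \<longleftrightarrow> \<omega> \<in> {\<omega> \<in> space M. U \<omega> \<le> cdf \<mu> x}"
        using AE
      proof eventually_elim
        case (elim \<omega>)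
        then have "U \<omega> \<le> cdf \<mu> x \<longleftrightarrow> J (U \<omega>) \<le> x"
          using \<mu>.pseudoinverse[of "U \<omega>" x] by (simp add: J_def)
        then show ?case by simp
      qed
    qed auto
    also have "\<dots> = cdf \<mu> x" by (rule Up) (auto simp: \<mu>.cdf_nonneg \<mu>.cdf_bounded_prob)
    finally show ?thesis .
  qed
  moreover have "real_distribution (distr M borel (\<lambda>\<omega>. J (U \<omega>)))"
    by (rule real_distribution_distr) measurable
  ultimately have "distr M borel (\<lambda>\<omega>. J (U \<omega>)) = \<mu>"
    using assms(2) by (intro cdf_unique) auto
  then show thesis by (intro that[of "\<lambda>\<omega>. J (U \<omega>)"]) auto
qed

section \<open>Random vectors on an atomless space\<close>

lemma borel_measurable_vec_lambda:
  fixes X :: "'n::finite \<Rightarrow> 'a \<Rightarrow> real"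
  assumes "\<And>i. X i \<in> borel_measurable M"
  shows "(\<lambda>\<omega>. \<chi> i. X i \<omega>) \<in> borel_measurable M"
  unfolding borel_measurable_euclidean_space[of "\<lambda>\<omega>. \<chi> i. X i \<omega>"]
  using assms by (auto simp: Basis_vec_def inner_axis)

lemma borel_measurable_vec_nth: "(\<lambda>x :: real ^ 'n. x $ i) \<in> borel_measurable borel"
  by (intro borel_measurable_continuous_onI continuous_intros)

text \<open>Base 4 rather than base 2 makes the expansion injective on all bit sequences, and the tail
  after any digit sums to at most one third of the unit in that place.\<close>

definition base4 :: "(nat \<Rightarrow> bool) \<Rightarrow> real" where
  "base4 b = (\<Sum>k. of_bool (b k) * (1 / 4) ^ Suc k)"

lemma summable_base4: "summable (\<lambda>k. of_bool (b k) * (1 / 4 :: real) ^ Suc k)"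
  by (rule summable_comparison_test'[where g="\<lambda>k. (1 / 4) ^ k" and N=0])
    (auto simp: summable_geometric_iff)

lemma base4_rec: "base4 b = (of_bool (b 0) + base4 (\<lambda>k. b (Suc k))) / 4"
proof -
  have "base4 b = (\<Sum>k. 1 / 4 * (of_bool (b (Suc k)) * (1 / 4) ^ Suc k)) + of_bool (b 0) / 4"
    using suminf_split_head[OF summable_base4, of b] by (simp add: base4_def mult_ac)
  also have "(\<Sum>k. 1 / 4 * (of_bool (b (Suc k)) * (1 / 4) ^ Suc k)) = 1 / 4 * base4 (\<lambda>k. b (Suc k))"
    unfolding base4_def by (rule suminf_mult[OF summable_base4])
  finally show ?thesis by simp
qed

lemma base4_bounds: "0 \<le> base4 b" "base4 b < 1"
proof -
  show "0 \<le> base4 b" unfolding base4_def by (intro suminf_nonneg summable_base4) simp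
  have s: "(\<lambda>k. (1 / 4 :: real) ^ Suc k) sums (1 / 3)"
    using sums_mult[OF geometric_sums[of "1 / 4 :: real"], of "1 / 4"] by simp
  have "base4 b \<le> (\<Sum>k. (1 / 4 :: real) ^ Suc k)"
    unfolding base4_def using s by (intro suminf_le summable_base4) (auto simp: sums_iff)
  then show "base4 b < 1" using s by (simp add: sums_iff)
qed

text \<open>Multiplication by \<open>4 ^ Suc k\<close> moves digit \<open>k\<close> to the unit
  place. The earlier digits contribute a multiple of 4 and the tail is below 1, so the parity of the
  floor is the bit.\<close>

lemma odd_floor_base4: "odd \<lfloor>4 ^ Suc k * base4 b\<rfloor> \<longleftrightarrow> b k"
proof (induction k arbitrary: b)
  case 0
  have "4 * base4 b = of_int (of_bool (b 0)) + base4 (\<lambda>k. b (Suc k))"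
    by (subst base4_rec) simp
  then have "\<lfloor>4 * base4 b\<rfloor> = of_bool (b 0)"
    using base4_bounds[of "\<lambda>k. b (Suc k)"] by (intro floor_unique) auto
  then show ?case by simp
next
  case (Suc k)
  have "4 ^ Suc (Suc k) * base4 b
    = of_int (4 ^ Suc k * of_bool (b 0)) + 4 ^ Suc k * base4 (\<lambda>k. b (Suc k))"
    by (subst base4_rec) (simp add: algebra_simps)
  then have "\<lfloor>4 ^ Suc (Suc k) * base4 b\<rfloor>
    = 4 ^ Suc k * of_bool (b 0) + \<lfloor>4 ^ Suc k * base4 (\<lambda>k. b (Suc k))\<rfloor>"
    by (metis add.commute floor_add_int)
  then show ?case using Suc.IH[of "\<lambda>k. b (Suc k)"] by simp
qed

text \<open>A vector is determined by the countably many truth values of \<open>x $ i < q\<close>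
  with \<open>q\<close> rational. \<open>\<phi>\<close> packs them into one real;
  \<open>\<psi>\<close> reads them off and recovers \<open>x $ i\<close> as the infimum of the
  admissible \<open>q\<close>.\<close>

lemma vec_real_measurable_retract:
  obtains \<phi> :: "real ^ 'n \<Rightarrow> real" and \<psi> :: "real \<Rightarrow> real ^ 'n"
  where "\<phi> \<in> borel_measurable borel" "\<psi> \<in> borel_measurable borel" "\<And>x. \<psi> (\<phi> x) = x"
proof -
  define e where "e = from_nat_into (UNIV :: ('n \<times> rat) set)"
  have e: "\<exists>k. e k = y" for y
    unfolding e_def by (intro from_nat_into_surj) auto
  define \<phi> :: "real ^ 'n \<Rightarrow> real" where
    "\<phi> x = base4 (\<lambda>k. x $ fst (e k) < of_rat (snd (e k)))" for x
  \<comment> \<open>In \<open>ereal\<close> the infimum exists for any sequence of bits; the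
    infinite value stands for pairs that do not contribute, and \<open>real_of_ereal\<close> gives
    \<open>\<psi>\<close> a value off the range of \<open>\<phi>\<close> as well.\<close>
  define \<psi> :: "real \<Rightarrow> real ^ 'n" where
    "\<psi> z = (\<chi> i. real_of_ereal (INF k. if fst (e k) = i \<and> odd \<lfloor>4 ^ Suc k * z\<rfloor>
        then ereal (of_rat (snd (e k))) else \<infinity>))" for z
  note [measurable] = borel_measurable_vec_nth
  have [measurable]: "\<phi> \<in> borel_measurable borel"
    unfolding \<phi>_def base4_def of_bool_def by measurable
  have [measurable]: "\<psi> \<in> borel_measurable borel"
    unfolding \<psi>_def by (rule borel_measurable_vec_lambda) measurable
  have "\<psi> (\<phi> x) = x" for x
  proof -
    have "(INF k. if fst (e k) = i \<and> x $ fst (e k) < of_rat (snd (e k))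
      then ereal (of_rat (snd (e k))) else \<infinity>) = ereal (x $ i)" for i
    proof (rule antisym)
      show "ereal (x $ i) \<le> (INF k. if fst (e k) = i \<and> x $ fst (e k) < of_rat (snd (e k))
        then ereal (of_rat (snd (e k))) else \<infinity>)"
        by (intro INF_greatest) auto
      show "(INF k. if fst (e k) = i \<and> x $ fst (e k) < of_rat (snd (e k))
        then ereal (of_rat (snd (e k))) else \<infinity>) \<le> ereal (x $ i)"
      proof (rule dense_ge)
        fix y assume "ereal (x $ i) < y"
        then obtain r where r: "x $ i < r" "ereal r < y"
          using ereal_dense2[of "ereal (x $ i)" y] by auto
        then obtain q where q: "x $ i < of_rat q" "of_rat q < r"
          using of_rat_dense by blast
        obtain k where "e k = (i, q)" using e by blast
        with q r show "(INF k. if fst (e k) = i \<and> x $ fst (e k) < of_rat (snd (e k))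
          then ereal (of_rat (snd (e k))) else \<infinity>) \<le> y"
          by (intro INF_lower2[of k]) (auto intro!: less_imp_le elim: less_trans[rotated])
      qed
    qed
    then show ?thesis
      by (simp add: \<psi>_def \<phi>_def odd_floor_base4 vec_eq_iff del: power_Suc)
  qed
  then show thesis by (intro that[of \<phi> \<psi>]) auto
qed

text \<open>Push \<open>\<nu>\<close> to the line by \<open>\<phi>\<close>, realise the image law by
  \<open>Z\<close>, and return by \<open>\<psi>\<close>, which undoes \<open>\<phi>\<close>.\<close>

lemma (in prob_space) atomless_vec_distribution:
  fixes \<nu> :: "(real ^ 'n) measure"
  assumes "atomless M" "prob_space \<nu>" and sets: "sets \<nu> = sets borel"
  obtains Y where "Y \<in> borel_measurable M" "distr M borel Y = \<nu>"
proof -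
  obtain \<phi> :: "real ^ 'n \<Rightarrow> real" and \<psi> where
    [measurable]: "\<phi> \<in> borel_measurable borel" "\<psi> \<in> borel_measurable borel"
    and \<psi>\<phi>: "\<And>x. \<psi> (\<phi> x) = x"
    by (rule vec_real_measurable_retract) blast
  have [measurable]: "\<phi> \<in> borel_measurable \<nu>"
    by (simp add: measurable_cong_sets[OF sets refl])
  have "real_distribution (distr \<nu> borel \<phi>)"
    by (intro prob_space.real_distribution_distr assms) measurable
  then obtain Z where [measurable]: "Z \<in> borel_measurable M" and Z: "distr M borel Z = distr \<nu> borel \<phi>"
    using atomless_real_distribution[OF assms(1)] by metis
  have "distr M borel (\<psi> \<circ> Z) = distr (distr \<nu> borel \<phi>) borel \<psi>"
    by (subst Z[symmetric], subst distr_distr) auto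
  also have "\<dots> = distr \<nu> borel (\<lambda>x. x)"
    by (subst distr_distr) (auto simp: o_def \<psi>\<phi>)
  also have "\<dots> = \<nu>" by (rule distr_id2) (rule sets[symmetric])
  finally show thesis by (intro that[of "\<psi> \<circ> Z"]) auto
qed

lemma rv_cdf_eq:
  assumes "X \<in> borel_measurable M"
  shows "rv_cdf M X x = measure M {\<omega> \<in> space M. X \<omega> \<le> x}"
  using assms unfolding rv_cdf_def cdf_def
  by (subst measure_distr) (auto intro!: arg_cong[where f="measure M"])

text \<open>\<open>Y\<close> has the law of \<open>X \<pi>\<close> with \<open>\<pi>\<close> drawn
  independently from \<open>p\<close>. This law is formed as the bind \<open>\<nu>\<close> and then
  realised on \<open>M\<close>. Quantifying over \<open>g\<close> after \<open>Y\<close> lets one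
  \<open>Y\<close> serve all coordinates and the function \<open>f\<close>.\<close>

lemma (in prob_space) atomless_mixture:
  fixes p :: "'i::finite pmf" and X :: "'i \<Rightarrow> 'a \<Rightarrow> real ^ 'n"
  assumes "atomless M" and X: "\<And>\<pi>. X \<pi> \<in> borel_measurable M"
  obtains Y where "Y \<in> borel_measurable M"
    and "\<And>g x. g \<in> borel_measurable borel \<Longrightarrow>
      rv_cdf M (\<lambda>\<omega>. g (Y \<omega>)) x = (\<Sum>\<pi>\<in>UNIV. pmf p \<pi> * rv_cdf M (\<lambda>\<omega>. g (X \<pi> \<omega>)) x)"
proof -
  note [measurable] = X
  define K where "K \<pi> = distr M borel (X \<pi>)" for \<pi>
  have K: "K \<in> measure_pmf p \<rightarrow>\<^sub>M prob_algebra borel"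
    unfolding K_def by (simp add: space_prob_algebra prob_space_distr)
  then have K': "K \<in> measure_pmf p \<rightarrow>\<^sub>M subprob_algebra borel"
    by (rule measurable_prob_algebraD)
  define \<nu> where "\<nu> = measure_pmf p \<bind> K"
  have "measure_pmf p \<in> space (prob_algebra (measure_pmf p))"
    by (simp add: space_prob_algebra measure_pmf.prob_space_axioms)
  then have "prob_space \<nu>" "sets \<nu> = sets borel"
    unfolding \<nu>_def using K by (rule prob_space_bind', rule sets_bind')
  then obtain Y where [measurable]: "Y \<in> borel_measurable M" and Y: "distr M borel Y = \<nu>"
    using atomless_vec_distribution[OF assms(1)] by metis
  have "rv_cdf M (\<lambda>\<omega>. g (Y \<omega>)) x = (\<Sum>\<pi>\<in>UNIV. pmf p \<pi> * rv_cdf M (\<lambda>\<omega>. g (X \<pi> \<omega>)) x)"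
    if [measurable]: "g \<in> borel_measurable borel" for g and x :: real
  proof -
    have rv: "rv_cdf M (\<lambda>\<omega>. g (W \<omega>)) x = measure (distr M borel W) {y. g y \<le> x}"
      if [measurable]: "W \<in> borel_measurable M" for W :: "'a \<Rightarrow> real ^ 'n"
      by (subst rv_cdf_eq, measurable, subst measure_distr)
        (auto intro!: arg_cong[where f="measure M"])
    have "measure \<nu> {y. g y \<le> x} = (\<integral>\<pi>. measure (K \<pi>) {y. g y \<le> x} \<partial>measure_pmf p)"
      unfolding \<nu>_def using K' by (intro measure_pmf.measure_bind) auto
    also have "\<dots> = (\<Sum>\<pi>\<in>UNIV. pmf p \<pi> * measure (K \<pi>) {y. g y \<le> x})"
      by (subst integral_measure_pmf_real[of UNIV]) (auto simp: mult.commute)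
    finally show ?thesis by (simp add: rv Y K_def)
  qed
  then show thesis by (intro that[of Y]) auto
qed

section \<open>Birkhoff's theorem\<close>

definition perm_matrix :: "('n \<Rightarrow> 'n) \<Rightarrow> real ^ 'n ^ 'n" where
  "perm_matrix \<pi> = (\<chi> i j. of_bool (\<pi> i = j))"

lemma doubly_stochasticD:
  assumes "doubly_stochastic L"
  shows "0 \<le> L $ i $ j" "(\<Sum>j\<in>UNIV. L $ i $ j) = 1" "(\<Sum>i\<in>UNIV. L $ i $ j) = 1"
  using assms by (auto simp: doubly_stochastic_def)

lemma doubly_stochastic_le_1:
  assumes "doubly_stochastic L"
  shows "L $ i $ j \<le> 1"
  using member_le_sum[of j UNIV "\<lambda>j. L $ i $ j"] doubly_stochasticD[OF assms] by simp

lemma compact_doubly_stochastic: "compact {L :: real ^ 'n ^ 'n. doubly_stochastic L}"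
  unfolding compact_eq_bounded_closed
proof
  have "norm L \<le> (\<Sum>i\<in>(UNIV :: 'n set). \<Sum>j\<in>(UNIV :: 'n set). 1)"
    if "doubly_stochastic L" for L :: "real ^ 'n ^ 'n"
  proof -
    have "norm L \<le> (\<Sum>i\<in>UNIV. norm (L $ i))"
      unfolding norm_vec_def[of L] by (rule L2_set_le_sum) simp
    also have "\<dots> \<le> (\<Sum>i\<in>UNIV. \<Sum>j\<in>UNIV. \<bar>L $ i $ j\<bar>)"
      by (intro sum_mono norm_le_l1_cart)
    also have "\<dots> \<le> (\<Sum>i\<in>(UNIV :: 'n set). \<Sum>j\<in>(UNIV :: 'n set). 1)"
      using doubly_stochasticD(1)[OF that] doubly_stochastic_le_1[OF that]
      by (intro sum_mono) (simp add: abs_le_iff)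
    finally show ?thesis .
  qed
  then show "bounded {L :: real ^ 'n ^ 'n. doubly_stochastic L}"
    by (intro boundedI) auto
  show "closed {L :: real ^ 'n ^ 'n. doubly_stochastic L}"
    unfolding doubly_stochastic_def
    by (intro closed_Collect_conj closed_Collect_all closed_Collect_le closed_Collect_eq
        continuous_intros)
qed

lemma convex_doubly_stochastic: "convex {L :: real ^ 'n ^ 'n. doubly_stochastic L}"
  by (rule convexI) (auto simp: doubly_stochastic_def sum.distrib simp flip: sum_distrib_left)

text \<open>Were all other entries integers, \<open>a j\<close> would be 1 minus an integer. Applied
  to rows and columns, this excludes vertices of degree 1 in the graph of fractional
  entries.\<close>

lemma fractional_not_alone:
  fixes a :: "'n::finite \<Rightarrow> real"
  assumes "\<And>k. 0 \<le> a k" "sum a UNIV = 1" "0 < a j" "a j < 1"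
  shows "\<exists>k. k \<noteq> j \<and> 0 < a k \<and> a k < 1"
proof (rule ccontr)
  assume no: "\<nexists>k. k \<noteq> j \<and> 0 < a k \<and> a k < 1"
  have "a k \<in> \<int>" if "k \<noteq> j" for k
  proof -
    have "a k \<le> 1" using member_le_sum[of k UNIV a] assms by simp
    then have "a k = 0 \<or> a k = 1"
      using that no assms(1)[of k] by (meson antisym not_le)
    then show ?thesis by auto
  qed
  then have "sum a (UNIV - {j}) \<in> \<int>" by (intro Ints_sum) auto
  moreover have "a j = 1 - sum a (UNIV - {j})" using assms(2) by (simp add: sum.remove[of UNIV j])
  ultimately have "a j \<in> \<int>" by simp
  then show False using assms(3,4) by (auto elim!: Ints_cases)
qed

text \<open>Every fibre has at least two points. For the projections of an edge set to rows and to
  columns, the two bounds add up to at least as many edges as vertices.\<close>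

lemma card_ge_2_fibres:
  fixes f :: "'p \<Rightarrow> 'q"
  assumes "finite S" "\<And>p. p \<in> S \<Longrightarrow> \<exists>p'\<in>S. p' \<noteq> p \<and> f p' = f p"
  shows "2 * card (f ` S) \<le> card S"
proof -
  have "2 * card (f ` S) = (\<Sum>y\<in>f ` S. 2)" by simp
  also have "\<dots> \<le> (\<Sum>y\<in>f ` S. card {p\<in>S. f p = y})"
  proof (rule sum_mono)
    fix y assume "y \<in> f ` S"
    then obtain p p' where "p \<in> S" "p' \<in> S" "p' \<noteq> p" "f p' = y" "f p = y" using assms(2) by blast
    then have "card {p, p'} \<le> card {p\<in>S. f p = y}" using assms(1) by (intro card_mono) auto
    then show "2 \<le> card {p\<in>S. f p = y}" using \<open>p' \<noteq> p\<close> by simp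
  qed
  also have "\<dots> = card S" 
    using sum.image_gen[OF assms(1), of "\<lambda>_. 1 :: nat" f] by simp
  finally show ?thesis .
qed

text \<open>The incidence vectors of the edges of a bipartite graph lie in the hyperplane on which the two
  vertex classes have equal total weight, hence their rank is below the number of vertices.\<close>

lemma dependent_incidence_vectors:
  fixes S :: "('n::finite \<times> 'n) set"
  assumes "S \<noteq> {}" and card: "card (fst ` S) + card (snd ` S) \<le> card S"
  defines "v \<equiv> \<lambda>p. (axis (fst p) 1, axis (snd p) 1) :: (real ^ 'n) \<times> (real ^ 'n)"
  shows "dependent (v ` S)"
proof (rule ccontr)
  assume ind: "independent (v ` S)"
  have inj: "inj_on v S" by (auto simp: inj_on_def v_def axis_eq_axis)
  define g :: "(real ^ 'n) \<times> (real ^ 'n) \<Rightarrow> real"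
    where "g x = (\<Sum>i\<in>UNIV. fst x $ i) - (\<Sum>j\<in>UNIV. snd x $ j)" for x
  have g_v: "g (v p) = 0" for p by (simp add: g_def v_def axis_def)
  have "span (v ` S) \<subseteq> {x. g x = 0}"
    by (rule span_minimal)
      (auto simp: g_v subspace_def, auto simp: g_def sum.distrib simp flip: sum_distrib_left right_diff_distrib)
  moreover from \<open>S \<noteq> {}\<close> obtain i j where ij: "(i, j) \<in> S" by auto
  \<comment> \<open>A single vertex vector leaves the hyperplane \<open>g x = 0\<close>, so it can
    be added to the edge vectors without losing independence. This makes \<open>card S + 1\<close>
    independent vectors in the span of the at most \<open>card S\<close> vertex vectors
    \<open>T\<close>.\<close>
  define w where "w = (axis i 1 :: real ^ 'n, 0 :: real ^ 'n)"
  have "g w = 1" by (simp add: g_def w_def axis_def)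
  ultimately have "w \<notin> span (v ` S)" by auto
  then have w: "w \<notin> v ` S" "independent (insert w (v ` S))"
    using ind by (auto simp: independent_insert intro: span_base)
  define T where "T = (\<lambda>i. (axis i 1 :: real ^ 'n, 0 :: real ^ 'n)) ` fst ` S
    \<union> (\<lambda>j. (0 :: real ^ 'n, axis j 1 :: real ^ 'n)) ` snd ` S"
  have "w \<in> T" using ij by (force simp: w_def T_def)
  have "v p \<in> span T" if "p \<in> S" for p
  proof -
    have "v p = (axis (fst p) 1, 0) + (0, axis (snd p) 1)" by (simp add: v_def)
    moreover have "(axis (fst p) 1, 0) \<in> T" "(0, axis (snd p) 1) \<in> T" using that by (auto simp: T_def)
    ultimately show ?thesis by (simp only: span_add span_base)
  qed
  then have "insert w (v ` S) \<subseteq> span T" using \<open>w \<in> T\<close> by (auto intro: span_base)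
  then have "card (insert w (v ` S)) \<le> card T"
    using independent_span_bound[OF _ w(2), of T] by (simp add: T_def)
  also have "\<dots> \<le> card (fst ` S) + card (snd ` S)"
    unfolding T_def by (intro order_trans[OF card_Un_le] add_mono card_image_le) auto
  also have "\<dots> \<le> card S" by fact
  finally show False using w(1) inj by (simp add: card_image)
qed

text \<open>A linear dependency among the edges of the graph of fractional entries is a nonzero
  matrix \<open>E\<close> with vanishing row and column sums. Then \<open>L\<close> is the midpoint
  of two distinct doubly stochastic matrices \<open>L + \<epsilon> *\<^sub>R E\<close> and
  \<open>L - \<epsilon> *\<^sub>R E\<close>.\<close>

lemma doubly_stochastic_extreme_01:
  fixes L :: "real ^ 'n ^ 'n"
  assumes ext: "L extreme_point_of {L. doubly_stochastic L}"
  shows "L $ i $ j = 0 \<or> L $ i $ j = 1"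
proof (rule ccontr)
  assume no: "\<not> (L $ i $ j = 0 \<or> L $ i $ j = 1)"
  have L: "doubly_stochastic L" using ext by (simp add: extreme_point_of_def)
  note L0 = doubly_stochasticD[OF L] and L1 = doubly_stochastic_le_1[OF L]
  define S where "S = {(i, j). 0 < L $ i $ j \<and> L $ i $ j < 1}"
  have "(i, j) \<in> S" using no L0(1)[of i j] L1[of i j] by (auto simp: S_def less_le)
  then have "S \<noteq> {}" by auto
  have "2 * card (fst ` S) \<le> card S"
  proof (rule card_ge_2_fibres)
    fix p assume "p \<in> S"
    then obtain i j where p: "p = (i, j)" "0 < L $ i $ j" "L $ i $ j < 1" by (auto simp: S_def)
    obtain k where "k \<noteq> j" "0 < L $ i $ k" "L $ i $ k < 1"
      using fractional_not_alone[of "\<lambda>k. L $ i $ k" j] p L0 by blast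
    then show "\<exists>p'\<in>S. p' \<noteq> p \<and> fst p' = fst p"
      using p by (intro bexI[of _ "(i, k)"]) (auto simp: S_def)
  qed simp
  moreover have "2 * card (snd ` S) \<le> card S"
  proof (rule card_ge_2_fibres)
    fix p assume "p \<in> S"
    then obtain i j where p: "p = (i, j)" "0 < L $ i $ j" "L $ i $ j < 1" by (auto simp: S_def)
    obtain k where "k \<noteq> i" "0 < L $ k $ j" "L $ k $ j < 1"
      using fractional_not_alone[of "\<lambda>k. L $ k $ j" i] p L0 by blast
    then show "\<exists>p'\<in>S. p' \<noteq> p \<and> snd p' = snd p"
      using p by (intro bexI[of _ "(k, j)"]) (auto simp: S_def)
  qed simp
  ultimately have card: "card (fst ` S) + card (snd ` S) \<le> card S" by linarith
  define v where "v = (\<lambda>p. (axis (fst p) 1, axis (snd p) 1) :: (real ^ 'n) \<times> (real ^ 'n))"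
  have inj: "inj_on v S" by (auto simp: inj_on_def v_def axis_eq_axis)
  have "dependent (v ` S)"
    unfolding v_def using \<open>S \<noteq> {}\<close> card by (rule dependent_incidence_vectors)
  then obtain u where u: "\<exists>p\<in>S. u (v p) \<noteq> 0" "(\<Sum>p\<in>S. u (v p) *\<^sub>R v p) = 0"
    by (auto simp: dependent_finite sum.reindex[OF inj])
  define E :: "real ^ 'n ^ 'n" where "E = (\<chi> i j. if (i, j) \<in> S then u (v (i, j)) else 0)"
  have E0: "E $ i $ j = 0" if "(i, j) \<notin> S" for i j using that by (simp add: E_def)
  have "E \<noteq> 0" using u(1) by (auto simp: E_def vec_eq_iff)
  \<comment> \<open>Coordinate \<open>i\<close> of the first component of the dependency is the sum
    of row \<open>i\<close> of \<open>E\<close>; the second component gives the column sums.\<close>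
  have row: "(\<Sum>j\<in>UNIV. E $ i $ j) = 0" for i
  proof -
    have "0 = (\<Sum>p\<in>S. fst (u (v p) *\<^sub>R v p) $ i)"
      using arg_cong[OF u(2), of "\<lambda>x. fst x $ i"] by (simp add: fst_sum)
    also have "\<dots> = (\<Sum>p\<in>S. if fst p = i then u (v p) else 0)"
      by (intro sum.cong) (auto simp: v_def axis_def)
    also have "\<dots> = (\<Sum>p\<in>UNIV \<times> UNIV. if fst p = i then E $ fst p $ snd p else 0)"
      by (intro sum.mono_neutral_cong_left) (auto simp: E_def)
    also have "\<dots> = (\<Sum>k\<in>UNIV. if k = i then \<Sum>j\<in>UNIV. E $ k $ j else 0)"
      unfolding sum.cartesian_product' by (intro sum.cong) auto
    finally show ?thesis by simp
  qed
  have col: "(\<Sum>i\<in>UNIV. E $ i $ j) = 0" for j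
  proof -
    have "0 = (\<Sum>p\<in>S. snd (u (v p) *\<^sub>R v p) $ j)"
      using arg_cong[OF u(2), of "\<lambda>x. snd x $ j"] by (simp add: snd_sum)
    also have "\<dots> = (\<Sum>p\<in>S. if snd p = j then u (v p) else 0)"
      by (intro sum.cong) (auto simp: v_def axis_def)
    also have "\<dots> = (\<Sum>p\<in>UNIV \<times> UNIV. if snd p = j then E $ fst p $ snd p else 0)"
      by (intro sum.mono_neutral_cong_left) (auto simp: E_def)
    also have "\<dots> = (\<Sum>k\<in>UNIV. \<Sum>l\<in>UNIV. if l = j then E $ k $ l else 0)"
      unfolding sum.cartesian_product' by simp
    finally show ?thesis by simp
  qed
  \<comment> \<open>Small enough to keep all entries nonnegative; the \<open>+ 1\<close> keeps the
    denominators positive where \<open>E\<close> vanishes.\<close>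
  define \<epsilon> where "\<epsilon> = Min ((\<lambda>(i, j). L $ i $ j / (\<bar>E $ i $ j\<bar> + 1)) ` S)"
  have "0 < \<epsilon>"
    unfolding \<epsilon>_def using \<open>S \<noteq> {}\<close> by (subst Min_gr_iff) (auto simp: S_def)
  have bound: "\<epsilon> * \<bar>E $ i $ j\<bar> \<le> L $ i $ j" for i j
  proof (cases "(i, j) \<in> S")
    case True
    then have "\<epsilon> \<le> L $ i $ j / (\<bar>E $ i $ j\<bar> + 1)"
      unfolding \<epsilon>_def by (intro Min_le) auto
    then have "\<epsilon> * (\<bar>E $ i $ j\<bar> + 1) \<le> L $ i $ j"
      by (subst (asm) pos_le_divide_eq) auto
    then show ?thesis using \<open>0 < \<epsilon>\<close> by (simp add: distrib_left)
  qed (simp add: E0 L0)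
  have "doubly_stochastic (L + c *\<^sub>R E)" if "\<bar>c\<bar> = \<epsilon>" for c
  proof -
    have "0 \<le> L $ i $ j + c * E $ i $ j" for i j
      using bound[of i j] abs_mult[of c "E $ i $ j"] unfolding that by linarith
    then show ?thesis
      by (simp add: doubly_stochastic_def sum.distrib L0 row col flip: sum_distrib_left)
  qed
  from this[of \<epsilon>] this[of "-\<epsilon>"] \<open>0 < \<epsilon>\<close>
  have "doubly_stochastic (L + \<epsilon> *\<^sub>R E)" "doubly_stochastic (L - \<epsilon> *\<^sub>R E)" by simp_all
  moreover have "L = (1 - 1 / 2) *\<^sub>R (L + \<epsilon> *\<^sub>R E) + (1 / 2) *\<^sub>R (L - \<epsilon> *\<^sub>R E)"
    by (simp add: vec_eq_iff field_simps)
  moreover have "L + \<epsilon> *\<^sub>R E \<noteq> L - \<epsilon> *\<^sub>R E"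
  proof
    assume "L + \<epsilon> *\<^sub>R E = L - \<epsilon> *\<^sub>R E"
    then have "(2 * \<epsilon>) *\<^sub>R E = 0" by (simp add: algebra_simps flip: scaleR_2)
    then show False using \<open>E \<noteq> 0\<close> \<open>0 < \<epsilon>\<close> by simp
  qed
  ultimately have "L \<in> open_segment (L + \<epsilon> *\<^sub>R E) (L - \<epsilon> *\<^sub>R E)"
    unfolding in_segment by (intro conjI exI[of _ "1 / 2"]) auto
  with \<open>doubly_stochastic (L + _)\<close> \<open>doubly_stochastic (L - _)\<close> show False
    using ext unfolding extreme_point_of_def by blast
qed

text \<open>A row of zeros and ones with sum 1 has a single 1, in column \<open>\<pi> i\<close>. The
  column sums make \<open>\<pi>\<close> surjective, hence bijective on a finite type.\<close>

lemma doubly_stochastic_extreme_perm: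
  fixes L :: "real ^ 'n ^ 'n"
  assumes ext: "L extreme_point_of {L. doubly_stochastic L}"
  obtains \<pi> where "\<pi> permutes UNIV" "L = perm_matrix \<pi>"
proof -
  have L: "doubly_stochastic L" using ext by (simp add: extreme_point_of_def)
  note L0 = doubly_stochasticD[OF L] and L01 = doubly_stochastic_extreme_01[OF ext]
  have "\<exists>j. L $ i $ j = 1" for i
  proof (rule ccontr)
    assume "\<nexists>j. L $ i $ j = 1"
    then have "L $ i $ j = 0" for j using L01 by blast
    then show False using L0(2)[of i] by simp
  qed
  then obtain \<pi> where \<pi>: "\<And>i. L $ i $ \<pi> i = 1" by metis
  have eq: "L $ i $ j = of_bool (\<pi> i = j)" for i j
  proof -
    \<comment> \<open>The row minus its indicator is nonnegative with sum 0, so it vanishes.\<close>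
    have "(\<Sum>j\<in>UNIV. L $ i $ j - of_bool (\<pi> i = j)) = 0"
      by (simp add: sum_subtractf L0 of_bool_def)
    moreover have "0 \<le> L $ i $ j - of_bool (\<pi> i = j)" for j
      using \<pi>[of i] L0(1)[of i j] by (auto simp: of_bool_def)
    ultimately have "L $ i $ j - of_bool (\<pi> i = j) = 0"
      by (subst (asm) sum_nonneg_eq_0_iff) auto
    then show ?thesis by simp
  qed
  have "\<exists>i. \<pi> i = j" for j
  proof (rule ccontr)
    assume "\<nexists>i. \<pi> i = j"
    then show False using L0(3)[of j] by (simp add: eq)
  qed
  then have "surj \<pi>" by (metis surjI surj_def)
  then have "\<pi> permutes UNIV"
    by (intro bij_imp_permutes) (auto simp: bij_betw_def finite_UNIV_surj_inj)
  moreover have "L = perm_matrix \<pi>" by (simp add: vec_eq_iff perm_matrix_def eq)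
  ultimately show thesis by (rule that)
qed

text \<open>By Minkowski's form of Krein-Milman, \<open>L\<close> is a convex combination of extreme
  points, thus of permutation matrices. The weights, read as a probability mass function, describe a
  random permutation.\<close>

lemma Birkhoff:
  fixes L :: "real ^ 'n ^ 'n"
  assumes "doubly_stochastic L"
  obtains p where "set_pmf p \<subseteq> {\<pi>. \<pi> permutes UNIV}"
    and "\<And>i j. L $ i $ j = measure_pmf.prob p {\<pi>. \<pi> i = j}"
proof -
  let ?P = "{\<pi> :: 'n \<Rightarrow> 'n. \<pi> permutes UNIV}"
  have "L \<in> convex hull {L. L extreme_point_of {L. doubly_stochastic L}}"
    using Krein_Milman_Minkowski[OF compact_doubly_stochastic convex_doubly_stochastic] assms
    by blast
  also have "\<dots> \<subseteq> convex hull (perm_matrix ` ?P)"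
    by (intro hull_mono) (auto elim: doubly_stochastic_extreme_perm)
  finally obtain u where u: "\<And>A. A \<in> perm_matrix ` ?P \<Longrightarrow> 0 \<le> u A" "sum u (perm_matrix ` ?P) = 1"
    "(\<Sum>A\<in>perm_matrix ` ?P. u A *\<^sub>R A) = L"
    by (subst (asm) convex_hull_finite) auto
  have "inj (perm_matrix :: ('n \<Rightarrow> 'n) \<Rightarrow> real ^ 'n ^ 'n)"
  proof (rule injI)
    fix \<pi> \<sigma> :: "'n \<Rightarrow> 'n" assume "perm_matrix \<pi> = perm_matrix \<sigma>"
    then have "of_bool (\<pi> i = j) = (of_bool (\<sigma> i = j) :: real)" for i j
      by (simp add: perm_matrix_def vec_eq_iff)
    then show "\<pi> = \<sigma>" by (intro ext) (metis of_bool_eq_iff)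
  qed
  then have inj: "inj_on perm_matrix ?P" by (rule inj_on_subset) simp
  \<comment> \<open>The mass function lives on all maps of the index type, so the weights are
    extended by 0 beyond the permutations.\<close>
  define w where "w \<pi> = of_bool (\<pi> \<in> ?P) * u (perm_matrix \<pi>)" for \<pi>
  have w: "0 \<le> w \<pi>" for \<pi> using u(1) by (auto simp: w_def of_bool_def)
  have sum_w: "sum w UNIV = 1"
    using u(2) unfolding sum.reindex[OF inj]
    by (simp add: w_def of_bool_def sum.If_cases if_distrib[where f="\<lambda>c. c * _"] cong: if_cong)
  define p where "p = embed_pmf w"
  have p: "pmf p \<pi> = w \<pi>" for \<pi>
    unfolding p_def by (rule pmf_embed_pmf)
      (simp_all add: w nn_integral_count_space_finite sum_ennreal sum_w)
  show thesis
  proof (rule that[of p])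
    show "set_pmf p \<subseteq> ?P" by (auto simp: set_pmf_eq p w_def)
    fix i j
    have "L $ i $ j = (\<Sum>\<pi>\<in>?P. u (perm_matrix \<pi>) * of_bool (\<pi> i = j))"
      unfolding u(3)[symmetric] sum.reindex[OF inj] by (simp add: perm_matrix_def)
    also have "\<dots> = (\<Sum>\<pi>\<in>{\<pi>. \<pi> i = j}. w \<pi>)"
      by (intro sum.mono_neutral_cong) (auto simp: w_def)
    also have "\<dots> = measure_pmf.prob p {\<pi>. \<pi> i = j}"
      by (simp add: measure_measure_pmf_finite p)
    finally show "L $ i $ j = measure_pmf.prob p {\<pi>. \<pi> i = j}" .
  qed
qed

section \<open>Mixing the marginals\<close>

lemma Dset_mono_doubly_stochastic:
  fixes M :: "'a measure" and f :: "real ^ 'n \<Rightarrow> real"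
    and F :: "'n \<Rightarrow> real \<Rightarrow> real" and L :: "real ^ 'n ^ 'n"
  assumes "prob_space M" and "atomless M"
    and f: "f \<in> borel_measurable borel" and sym: "symmetric_fun f"
    and "doubly_stochastic L"
  shows "Dset M f F \<subseteq> Dset M f (mix L F)"
proof
  interpret prob_space M by fact
  fix G assume "G \<in> Dset M f F"
  then obtain X where X: "\<And>i. X i \<in> borel_measurable M" "\<And>i. rv_cdf M (X i) = F i"
    and G: "G = rv_cdf M (\<lambda>\<omega>. f (\<chi> i. X i \<omega>))"
    unfolding Dset_def by blast
  obtain p where perm: "set_pmf p \<subseteq> {\<pi>. \<pi> permutes UNIV}"
    and p: "\<And>i j. L $ i $ j = measure_pmf.prob p {\<pi>. \<pi> i = j}"
    using Birkhoff[OF assms(5)] by metis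
  have meas: "(\<lambda>\<omega>. \<chi> i. X (\<pi> i) \<omega>) \<in> borel_measurable M" for \<pi> :: "'n \<Rightarrow> 'n"
    by (intro borel_measurable_vec_lambda X)
  obtain Y where Y[measurable]: "Y \<in> borel_measurable M"
    and Y_cdf: "\<And>g x. g \<in> borel_measurable borel \<Longrightarrow> rv_cdf M (\<lambda>\<omega>. g (Y \<omega>)) x
      = (\<Sum>\<pi>\<in>UNIV. pmf p \<pi> * rv_cdf M (\<lambda>\<omega>. g (\<chi> i. X (\<pi> i) \<omega>)) x)"
    by (rule atomless_mixture[where X = "\<lambda>\<pi> \<omega>. \<chi> i. X (\<pi> i) \<omega>" and p = p, OF assms(2) meas]) blast
  note [measurable] = borel_measurable_vec_nth
  have pmf_sum: "(\<Sum>\<pi>\<in>UNIV. pmf p \<pi>) = 1" by (simp add: sum_pmf_eq_1)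
  have "rv_cdf M (\<lambda>\<omega>. Y \<omega> $ i) = mix L F i" for i
  proof
    fix x
    have "rv_cdf M (\<lambda>\<omega>. Y \<omega> $ i) x = (\<Sum>\<pi>\<in>UNIV. pmf p \<pi> * F (\<pi> i) x)"
      using Y_cdf[OF borel_measurable_vec_nth[of i], of x] by (simp add: X)
    \<comment> \<open>Grouping by \<open>j = \<pi> i\<close>: each group has total weight
      \<open>L $ i $ j\<close>.\<close>
    also have "\<dots> = (\<Sum>j\<in>UNIV. \<Sum>\<pi> | \<pi> \<in> UNIV \<and> \<pi> i = j. pmf p \<pi> * F (\<pi> i) x)"
      by (rule sum.group[symmetric]) auto
    also have "\<dots> = mix L F i x"
      by (simp add: mix_def p measure_measure_pmf_finite sum_distrib_right)
    finally show "rv_cdf M (\<lambda>\<omega>. Y \<omega> $ i) x = mix L F i x" .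
  qed
  moreover have "G = rv_cdf M (\<lambda>\<omega>. f (\<chi> i. Y \<omega> $ i))"
  proof
    fix x
    \<comment> \<open>The factor \<open>pmf p \<pi>\<close> stays on both sides because symmetry of
      \<open>f\<close> speaks only of permutations; other maps have weight 0.\<close>
    have "pmf p \<pi> * rv_cdf M (\<lambda>\<omega>. f (\<chi> i. X (\<pi> i) \<omega>)) x = pmf p \<pi> * G x" for \<pi>
    proof (cases "\<pi> \<in> set_pmf p")
      case True
      then have "\<pi> permutes UNIV" using perm by blast
      then have "f (\<chi> i. X (\<pi> i) \<omega>) = f (\<chi> i. X i \<omega>)" for \<omega>
        using sym[unfolded symmetric_fun_def, rule_format, of \<pi> "\<chi> i. X i \<omega>"] by simp
      then show ?thesis by (simp add: G)
    qed (simp add: set_pmf_iff)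
    then have "(\<Sum>\<pi>\<in>UNIV. pmf p \<pi> * rv_cdf M (\<lambda>\<omega>. f (\<chi> i. X (\<pi> i) \<omega>)) x) = G x"
      by (simp only: sum_distrib_right[symmetric] pmf_sum mult_1)
    then show "G x = rv_cdf M (\<lambda>\<omega>. f (\<chi> i. Y \<omega> $ i)) x"
      using Y_cdf[OF f, of x] by simp
  qed
  moreover have "(\<lambda>\<omega>. Y \<omega> $ i) \<in> borel_measurable M" for i by measurable
  ultimately show "G \<in> Dset M f (mix L F)"
    unfolding Dset_def by (intro CollectI exI[of _ "\<lambda>i \<omega>. Y \<omega> $ i"]) simp
qed

theorem theorem2:
  fixes M :: "'a measure" and f :: "real ^ 'n \<Rightarrow> real"
    and F :: "'n \<Rightarrow> real \<Rightarrow> real" and L :: "real ^ 'n ^ 'n"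
  assumes "prob_space M" and "atomless M"
    and "f \<in> borel_measurable borel" and "symmetric_fun f"
    and "\<forall>i. F i \<in> cdfs" and "doubly_stochastic L"
  shows "Dset M f F \<subseteq> Dset M f (mix L F)
     \<and> Dset M (\<lambda>x. \<Sum>i\<in>UNIV. x $ i) F \<subseteq> Dset M (\<lambda>x. \<Sum>i\<in>UNIV. x $ i) (mix L F)"
proof
  show "Dset M f F \<subseteq> Dset M f (mix L F)"
    using assms by (intro Dset_mono_doubly_stochastic)
  have "symmetric_fun (\<lambda>x :: real ^ 'n. \<Sum>i\<in>UNIV. x $ i)"
    unfolding symmetric_fun_def
  proof (intro allI impI)
    fix x :: "real ^ 'n" and \<pi> :: "'n \<Rightarrow> 'n"
    assume "\<pi> permutes UNIV"
    then show "(\<Sum>i\<in>UNIV. (\<chi> i. x $ \<pi> i) $ i) = (\<Sum>i\<in>UNIV. x $ i)"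
      using sum.permute[of \<pi> UNIV "\<lambda>i. x $ i"] by (simp add: o_def)
  qed
  moreover have "(\<lambda>x :: real ^ 'n. \<Sum>i\<in>UNIV. x $ i) \<in> borel_measurable borel"
    by (intro borel_measurable_sum borel_measurable_vec_nth)
  ultimately show "Dset M (\<lambda>x. \<Sum>i\<in>UNIV. x $ i) F \<subseteq> Dset M (\<lambda>x. \<Sum>i\<in>UNIV. x $ i) (mix L F)"
    using assms by (intro Dset_mono_doubly_stochastic)
qed

end
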